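(* Given the data-dictionary $\mathcal{D}_{N_\mathrm{d}}=\{u_k,p_k,x_k\}_{k=1}^{N_\mathrm{d}}$ measured from the LPV system $x_{k+1}=A(p_k)x_k+B(p_k)u_k$ (with affine dependence $A(p)=A_0+\sum_{i=1}^{n_\mathrm{p}}p_iA_i$, $B(p)=B_0+\sum_{i=1}^{n_\mathrm{p}}p_iB_i$) and satisfying the persistency of excitation condition that $D_\mathrm{p}:=\begin{bmatrix} X^\top & (X^\mathrm{p})^\top & U^\top & (U^\mathrm{p})^\top\end{bmatrix}^\top$ has full row rank $(1+n_\mathrm{p})(n_\mathrm{x}+n_\mathrm{u})$. For an LPV controller $u_k=K(p_k)x_k$ with $K(p)=K_0+\sum_{i=1}^{n_\mathrm{p}}p_iK_i$ and $\bar{K}=\begin{bmatrix}K_1 & \cdots & K_{n_\mathrm{p}}\end{bmatrix}$, the closed-loop system $x_{k+1}=(A(p_k)+B(p_k)K(p_k))x_k$ is represented equivalently as \[ x_{k+1}=X_+\mathcal{V}\begin{bmatrix} x_k\\ p_k\otimes x_k\\ p_k\otimes p_k\otimes x_k\end{bmatrix}, \] where $\mathcal{V}\in\mathbb{R}^{(N_\mathrm{d}-1)\times n_\mathrm{x}(1+n_\mathrm{p}+n_\mathrm{p}^2)}$ is any matrix that satisfies \[ \mathcal{M}_\mathrm{CL}:=\begin{bmatrix} I_{n_\mathrm{x}} & 0 & 0\\ 0 & I_{n_\mathrm{p}}\otimes I_{n_\mathrm{x}} & 0\\ K_0 & \bar{K} & 0\\ 0 & I_{n_\mathrm{p}}\otimes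 K_0 & I_{n_\mathrm{p}}\otimes\bar{K}\end{bmatrix}=\begin{bmatrix} X\\ X^\mathrm{p}\\ U\\ U^\mathrm{p}\end{bmatrix}\mathcal{V}. \]
   Context: Discrete-time LPV system $x_{k+1}=A(p_k)x_k+B(p_k)u_k$, $y_k=x_k$, with $x_k\in\mathbb{R}^{n_\mathrm{x}}$, $u_k\in\mathbb{R}^{n_\mathrm{u}}$, $p_k\in\mathbb{P}\subset\mathbb{R}^{n_\mathrm{p}}$ ($\mathbb{P}$ compact and convex), and $A,B$ affine in $p$. From the measured data $\mathcal{D}_{N_\mathrm{d}}=\{u^\mathrm{d}_k,p^\mathrm{d}_k,x^\mathrm{d}_k\}_{k=1}^{N_\mathrm{d}}$ the data matrices are $U=\begin{bmatrix}u^\mathrm{d}_1 & \cdots & u^\mathrm{d}_{N_\mathrm{d}-1}\end{bmatrix}$, $U^\mathrm{p}=\begin{bmatrix}p^\mathrm{d}_1\otimes u^\mathrm{d}_1 & \cdots & p^\mathrm{d}_{N_\mathrm{d}-1}\otimes u^\mathrm{d}_{N_\mathrm{d}-1}\end{bmatrix}$, $X=\begin{bmatrix}x^\mathrm{d}_1 & \cdots & x^\mathrm{d}_{N_\mathrm{d}-1}\end{bmatrix}$, $X^\mathrm{p}=\begin{bmatrix}p^\mathrm{d}_1\otimes x^\mathrm{d}_1 & \cdots & p^\mathrm{d}_{N_\mathrm{d}-1}\otimes x^\mathrm{d}_{N_\mathrm{d}-1}\end{bmatrix}$, $X_+=\begin{bmatrix}x^\mathrm{d}_2 & \cdots & x^\mathrm{d}_{N_\mathrm{d}}\end{bmatrix}$;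 $\otimes$ is the Kronecker product. *)

theory Defs
  imports "Jordan_Normal_Form.DL_Rank"
begin

definition kron :: "real mat \<Rightarrow> real mat \<Rightarrow> real mat" where
  "kron A B = mat (dim_row A * dim_row B) (dim_col A * dim_col B)
     (\<lambda>(i,j). A $$ (i div dim_row B, j div dim_col B) * B $$ (i mod dim_row B, j mod dim_col B))"

definition kron_vec :: "real vec \<Rightarrow> real vec \<Rightarrow> real vec" where
  "kron_vec p x = vec (dim_vec p * dim_vec x)
     (\<lambda>i. p $ (i div dim_vec x) * x $ (i mod dim_vec x))"

definition hcat :: "real mat \<Rightarrow> real mat \<Rightarrow> real mat" where
  "hcat A B = mat (dim_row A) (dim_col A + dim_col B)
     (\<lambda>(i,j). if j < dim_col A then A $$ (i,j) else B $$ (i, j - dim_col A))"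

text \<open>Affine parameter dependence M(p) = M_0 + sum_{i=1}^{np} p_i M_i,
  where the coefficient matrices are Ms 0, Ms 1, ..., Ms np (all nr x nc),
  and p is a vector of dimension np (p_i is p $ (i-1)).\<close>
definition affine_mat :: "nat \<Rightarrow> nat \<Rightarrow> nat \<Rightarrow> (nat \<Rightarrow> real mat) \<Rightarrow> real vec \<Rightarrow> real mat" where
  "affine_mat nr nc np Ms p = mat nr nc
     (\<lambda>(i,j). Ms 0 $$ (i,j) + (\<Sum>l<np. p $ l * Ms (Suc l) $$ (i,j)))"

definition bar_mat :: "nat \<Rightarrow> nat \<Rightarrow> nat \<Rightarrow> (nat \<Rightarrow> real mat) \<Rightarrow> real mat" where
  "bar_mat nr nc np Ms = mat nr (np * nc) (\<lambda>(i,j). Ms (Suc (j div nc)) $$ (i, j mod nc))"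

text \<open>Data matrix [w_1 ... w_{Nd-1}] (columns of dimension n), data indexed from 1.\<close>
definition data_mat :: "nat \<Rightarrow> nat \<Rightarrow> (nat \<Rightarrow> real vec) \<Rightarrow> real mat" where
  "data_mat n Nd w = mat n (Nd - 1) (\<lambda>(i,j). w (Suc j) $ i)"

definition full_row_rank :: "real mat \<Rightarrow> bool" where
  "full_row_rank M \<longleftrightarrow> vec_space.rank (dim_row M) M = dim_row M"

end

theory Submission
  imports Defs
begin

(* Stack the coefficient matrices as Theta = [A_0 Abar B_0 Bbar], so that
   A(p) x + B(p) u = Theta (x; p \<otimes> x; u; p \<otimes> u) and the data equations read X_+ = Theta D_p.
   Any V with M_CL = D_p V then gives X_+ V = Theta M_CL. Finally M_CL maps the lifted state
   (x; p \<otimes> x; p \<otimes> p \<otimes> x) to (x; p \<otimes> x; K(p) x; p \<otimes> K(p) x), on which Theta evaluates to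
   (A(p) + B(p) K(p)) x. Persistency of excitation only guarantees that such a V exists. *)

lemma sum_lessThan_mult_split:
  fixes f :: "nat \<Rightarrow> 'a::comm_monoid_add"
  shows "(\<Sum>j<a * b. f j) = (\<Sum>l<a. \<Sum>m<b. f (l * b + m))"
proof -
  have "sum f {l * b..<l * b + b} = (\<Sum>m<b. f (l * b + m))" for l
    using sum.shift_bounds_nat_ivl[of f 0 "l * b" b]
    by (simp add: atLeast0LessThan add.commute)
  then show ?thesis
    by (simp flip: sum.nat_group)
qed

lemma block_index_less:
  fixes l m a b :: nat
  assumes "l < a" "m < b"
  shows "l * b + m < a * b"
proof -
  have "l * b + m < Suc l * b" using assms(2) by simp
  also have "\<dots> \<le> a * b" using assms(1) by (intro mult_le_mono1) simp
  finally show ?thesis .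
qed

lemma dim_kron_vec [simp]: "dim_vec (kron_vec p x) = dim_vec p * dim_vec x"
  by (simp add: kron_vec_def)

lemma index_kron_vec [simp]:
  "i < dim_vec p * dim_vec x \<Longrightarrow> kron_vec p x $ i = p $ (i div dim_vec x) * x $ (i mod dim_vec x)"
  by (simp add: kron_vec_def)

lemma kron_vec_add_right:
  assumes "dim_vec a = n" "dim_vec b = n"
  shows "kron_vec p (a + b) = kron_vec p a + kron_vec p b"
proof (rule eq_vecI)
  fix i assume "i < dim_vec (kron_vec p a + kron_vec p b)"
  then have "i < dim_vec p * n"
    using assms by simp
  moreover from this have "i mod n < n"
    by (cases "n = 0") simp_all
  ultimately show "kron_vec p (a + b) $ i = (kron_vec p a + kron_vec p b) $ i"
    using assms by (simp add: distrib_left)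
qed (use assms in simp)

lemma dim_kron [simp]:
  "dim_row (kron A B) = dim_row A * dim_row B" "dim_col (kron A B) = dim_col A * dim_col B"
  by (simp_all add: kron_def)

lemma index_kron_block:
  assumes "i < dim_row A * dim_row B" "l < dim_col A" "m < dim_col B"
  shows "kron A B $$ (i, l * dim_col B + m) = A $$ (i div dim_row B, l) * B $$ (i mod dim_row B, m)"
  using assms block_index_less[OF assms(2,3)] by (simp add: kron_def)

lemma kron_one_one: "kron (1\<^sub>m m) (1\<^sub>m n) = 1\<^sub>m (m * n)"
proof (rule eq_matI)
  fix i j assume i: "i < dim_row (1\<^sub>m (m * n) :: real mat)" and j: "j < dim_col (1\<^sub>m (m * n) :: real mat)"
  then have "n > 0"
    by (cases n) simp_all
  with i j have "i div n < m" "j div n < m" "i mod n < n" "j mod n < n"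
    by (auto simp: less_mult_imp_div_less mult.commute)
  moreover have "(i div n = j div n \<and> i mod n = j mod n) = (i = j)"
    by (metis div_mult_mod_eq)
  ultimately show "kron (1\<^sub>m m) (1\<^sub>m n) $$ (i, j) = 1\<^sub>m (m * n) $$ (i, j)"
    using i j by (auto simp: kron_def)
qed simp_all

lemma dim_hcat [simp]:
  "dim_row (hcat A B) = dim_row A" "dim_col (hcat A B) = dim_col A + dim_col B"
  by (simp_all add: hcat_def)

lemma hcat_mult_append_vec:
  assumes "dim_row B = dim_row A" "dim_vec a = dim_col A" "dim_vec b = dim_col B"
  shows "hcat A B *\<^sub>v (a @\<^sub>v b) = A *\<^sub>v a + B *\<^sub>v b"
proof (rule eq_vecI)
  fix i assume "i < dim_vec (A *\<^sub>v a + B *\<^sub>v b)"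
  then have i: "i < dim_row A" using assms by simp
  have "row (hcat A B) i = row A i @\<^sub>v row B i"
    using assms i by (intro eq_vecI) (simp_all add: hcat_def)
  then have "(hcat A B *\<^sub>v (a @\<^sub>v b)) $ i = (row A i @\<^sub>v row B i) \<bullet> (a @\<^sub>v b)"
    using i by simp
  also have "\<dots> = row A i \<bullet> a + row B i \<bullet> b"
    using assms by (intro scalar_prod_append carrier_vecI) simp_all
  also have "\<dots> = (A *\<^sub>v a + B *\<^sub>v b) $ i"
    using assms i by simp
  finally show "(hcat A B *\<^sub>v (a @\<^sub>v b)) $ i = (A *\<^sub>v a + B *\<^sub>v b) $ i" .
qed (use assms in simp)

lemma zero_mat_mult_vec: "dim_vec v = m \<Longrightarrow> (0\<^sub>m n m :: 'a::comm_ring mat) *\<^sub>v v = 0\<^sub>v n"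
  by (intro eq_vecI) (auto simp: scalar_prod_def)

lemma index_mult_kron_vec:
  assumes "dim_col M = np * nc" "i < dim_row M" "dim_vec p = np" "dim_vec v = nc"
  shows "(M *\<^sub>v kron_vec p v) $ i = (\<Sum>l<np. p $ l * (\<Sum>m<nc. M $$ (i, l * nc + m) * v $ m))"
proof -
  have "(M *\<^sub>v kron_vec p v) $ i = (\<Sum>j<np * nc. M $$ (i, j) * (p $ (j div nc) * v $ (j mod nc)))"
    using assms by (simp add: scalar_prod_def atLeast0LessThan)
  also have "\<dots> = (\<Sum>l<np. \<Sum>m<nc. M $$ (i, l * nc + m) * (p $ l * v $ m))"
    unfolding sum_lessThan_mult_split by (intro sum.cong refl) auto
  finally show ?thesis
    by (simp add: sum_distrib_left mult_ac)
qed

lemma dim_bar_mat [simp]: "dim_row (bar_mat nr nc np Ms) = nr" "dim_col (bar_mat nr nc np Ms) = np * nc"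
  by (simp_all add: bar_mat_def)

lemma dim_affine_mat [simp]:
  "dim_row (affine_mat nr nc np Ms p) = nr" "dim_col (affine_mat nr nc np Ms p) = nc"
  by (simp_all add: affine_mat_def)

lemma affine_mat_carrier: "affine_mat nr nc np Ms p \<in> carrier_mat nr nc"
  by (intro carrier_matI) simp_all

lemma affine_mat_mult_vec:
  assumes "Ms 0 \<in> carrier_mat nr nc" "v \<in> carrier_vec nc" "p \<in> carrier_vec np"
  shows "affine_mat nr nc np Ms p *\<^sub>v v = Ms 0 *\<^sub>v v + bar_mat nr nc np Ms *\<^sub>v kron_vec p v"
proof (rule eq_vecI)
  fix i assume "i < dim_vec (Ms 0 *\<^sub>v v + bar_mat nr nc np Ms *\<^sub>v kron_vec p v)"
  then have i: "i < nr" using assms by simp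
  have "(affine_mat nr nc np Ms p *\<^sub>v v) $ i
      = (\<Sum>m<nc. Ms 0 $$ (i, m) * v $ m) + (\<Sum>m<nc. \<Sum>l<np. p $ l * (Ms (Suc l) $$ (i, m) * v $ m))"
    using i assms by (simp add: affine_mat_def scalar_prod_def atLeast0LessThan
        algebra_simps sum.distrib sum_distrib_left sum_distrib_right)
  also have "\<dots> = (\<Sum>m<nc. Ms 0 $$ (i, m) * v $ m) + (\<Sum>l<np. \<Sum>m<nc. p $ l * (Ms (Suc l) $$ (i, m) * v $ m))"
    by (simp only: sum.swap[of _ "{..<np}"])
  also have "\<dots> = (Ms 0 *\<^sub>v v + bar_mat nr nc np Ms *\<^sub>v kron_vec p v) $ i"
    using i assms by (subst index_add_vec, simp add: bar_mat_def,
        subst index_mult_kron_vec[of _ np nc])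
      (auto simp: bar_mat_def block_index_less sum_distrib_left scalar_prod_def atLeast0LessThan
        intro!: sum.cong)
  finally show "(affine_mat nr nc np Ms p *\<^sub>v v) $ i = (Ms 0 *\<^sub>v v + bar_mat nr nc np Ms *\<^sub>v kron_vec p v) $ i" .
qed (use assms in simp)

lemma kron_one_mult_kron_vec:
  assumes "dim_col B = dim_vec v" "p \<in> carrier_vec np"
  shows "kron (1\<^sub>m np) B *\<^sub>v kron_vec p v = kron_vec p (B *\<^sub>v v)"
proof (rule eq_vecI)
  fix i assume "i < dim_vec (kron_vec p (B *\<^sub>v v))"
  then have i: "i < np * dim_row B" using assms by simp
  then have l: "i div dim_row B < np" and r: "i mod dim_row B < dim_row B"
    by (simp_all add: less_mult_imp_div_less) (metis mod_less_divisor mult_0_right not_less_zero gr0I)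
  have "(kron (1\<^sub>m np) B *\<^sub>v kron_vec p v) $ i
      = (\<Sum>l<np. p $ l * (\<Sum>m<dim_vec v. (1\<^sub>m np $$ (i div dim_row B, l) * B $$ (i mod dim_row B, m)) * v $ m))"
    using i assms by (subst index_mult_kron_vec[of _ np "dim_vec v"])
      (auto simp: index_kron_block assms(1)[symmetric] intro!: sum.cong arg_cong2[where f = "(*)"])
  also have "\<dots> = (\<Sum>l<np. if l = i div dim_row B
      then p $ (i div dim_row B) * (\<Sum>m<dim_vec v. B $$ (i mod dim_row B, m) * v $ m) else 0)"
  proof (intro sum.cong refl)
    fix l assume "l \<in> {..<np}"
    then show "p $ l * (\<Sum>m<dim_vec v. 1\<^sub>m np $$ (i div dim_row B, l) * B $$ (i mod dim_row B, m) * v $ m)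
      = (if l = i div dim_row B
      then p $ (i div dim_row B) * (\<Sum>m<dim_vec v. B $$ (i mod dim_row B, m) * v $ m) else 0)"
      using l by (cases "l = i div dim_row B") simp_all
  qed
  also have "\<dots> = p $ (i div dim_row B) * (\<Sum>m<dim_vec v. B $$ (i mod dim_row B, m) * v $ m)"
    using l by simp
  also have "\<dots> = kron_vec p (B *\<^sub>v v) $ i"
    using i r assms by (simp add: scalar_prod_def atLeast0LessThan)
  finally show "(kron (1\<^sub>m np) B *\<^sub>v kron_vec p v) $ i = kron_vec p (B *\<^sub>v v) $ i" .
qed (use assms in simp)

lemma dim_append_rows [simp]:
  "dim_row (A @\<^sub>r B) = dim_row A + dim_row B" "dim_col (A @\<^sub>r B) = dim_col A"
  by (simp_all add: append_rows_def)

lemma append_rows_mult_vec: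
  assumes "dim_col A = dim_vec v" "dim_col B = dim_vec v"
  shows "(A @\<^sub>r B) *\<^sub>v v = A *\<^sub>v v @\<^sub>v B *\<^sub>v v"
  using assms by (intro mat_mult_append[of _ _ "dim_vec v"]) (auto intro: carrier_matI carrier_vecI)

lemma dim_data_mat [simp]: "dim_row (data_mat n Nd w) = n" "dim_col (data_mat n Nd w) = Nd - 1"
  by (simp_all add: data_mat_def)

lemma col_data_mat:
  assumes "j < Nd - 1" "dim_vec (w (Suc j)) = n"
  shows "col (data_mat n Nd w) j = w (Suc j)"
  using assms by (intro eq_vecI) (simp_all add: data_mat_def)

lemma data_mat_cong:
  assumes "\<forall>k\<in>{1..<Nd}. w k = w' k"
  shows "data_mat n Nd w = data_mat n Nd w'"
  unfolding data_mat_def using assms by (intro cong_mat) auto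

lemma append_rows_data_mat:
  assumes "\<forall>k\<in>{1..<Nd}. dim_vec (w k) = m \<and> dim_vec (w' k) = n"
  shows "data_mat m Nd w @\<^sub>r data_mat n Nd w' = data_mat (m + n) Nd (\<lambda>k. w k @\<^sub>v w' k)"
proof (rule eq_matI)
  fix i j assume "i < dim_row (data_mat (m + n) Nd (\<lambda>k. w k @\<^sub>v w' k))"
    and "j < dim_col (data_mat (m + n) Nd (\<lambda>k. w k @\<^sub>v w' k))"
  moreover from this have "dim_vec (w (Suc j)) = m" "dim_vec (w' (Suc j)) = n"
    using assms by simp_all
  ultimately show "(data_mat m Nd w @\<^sub>r data_mat n Nd w') $$ (i, j)
      = data_mat (m + n) Nd (\<lambda>k. w k @\<^sub>v w' k) $$ (i, j)"
    by (simp add: append_rows_def data_mat_def)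
qed (simp_all add: append_rows_def)

lemma mult_data_mat:
  assumes "T \<in> carrier_mat n m" "\<forall>k\<in>{1..<Nd}. dim_vec (w k) = m"
  shows "T * data_mat m Nd w = data_mat n Nd (\<lambda>k. T *\<^sub>v w k)"
proof (rule mat_col_eqI)
  fix j assume "j < dim_col (data_mat n Nd (\<lambda>k. T *\<^sub>v w k))"
  then have j: "j < Nd - 1" by simp
  have w: "dim_vec (w (Suc j)) = m" using assms(2) j by simp
  have D: "data_mat m Nd w \<in> carrier_mat m (Nd - 1)"
    by (intro carrier_matI) simp_all
  have "col (T * data_mat m Nd w) j = T *\<^sub>v col (data_mat m Nd w) j"
    using assms(1) D j by (rule col_mult2)
  also have "\<dots> = col (data_mat n Nd (\<lambda>k. T *\<^sub>v w k)) j"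
    using assms(1) j w by (simp add: col_data_mat)
  finally show "col (T * data_mat m Nd w) j = col (data_mat n Nd (\<lambda>k. T *\<^sub>v w k)) j" .
qed (use assms(1) in simp_all)

definition system_coeff_mat ::
  "nat \<Rightarrow> nat \<Rightarrow> nat \<Rightarrow> (nat \<Rightarrow> real mat) \<Rightarrow> (nat \<Rightarrow> real mat) \<Rightarrow> real mat" where
  "system_coeff_mat nx nu np As Bs =
     hcat (As 0) (hcat (bar_mat nx nx np As) (hcat (Bs 0) (bar_mat nx nu np Bs)))"

lemma system_coeff_mat_carrier:
  assumes "As 0 \<in> carrier_mat nx nx" "Bs 0 \<in> carrier_mat nx nu"
  shows "system_coeff_mat nx nu np As Bs \<in> carrier_mat nx (nx + (np * nx + (nu + np * nu)))"
  using assms by (intro carrier_matI) (simp_all add: system_coeff_mat_def)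

lemma system_coeff_mat_mult_vec:
  assumes "As 0 \<in> carrier_mat nx nx" "Bs 0 \<in> carrier_mat nx nu"
    and "x \<in> carrier_vec nx" "u \<in> carrier_vec nu" "p \<in> carrier_vec np"
  shows "system_coeff_mat nx nu np As Bs *\<^sub>v (x @\<^sub>v kron_vec p x @\<^sub>v u @\<^sub>v kron_vec p u)
    = affine_mat nx nx np As p *\<^sub>v x + affine_mat nx nu np Bs p *\<^sub>v u"
proof -
  let ?Ax = "As 0 *\<^sub>v x" and ?Apx = "bar_mat nx nx np As *\<^sub>v kron_vec p x"
  let ?Bu = "Bs 0 *\<^sub>v u" and ?Bpu = "bar_mat nx nu np Bs *\<^sub>v kron_vec p u"
  have "system_coeff_mat nx nu np As Bs *\<^sub>v (x @\<^sub>v kron_vec p x @\<^sub>v u @\<^sub>v kron_vec p u)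
      = ?Ax + (?Apx + (?Bu + ?Bpu))"
    using assms by (simp add: system_coeff_mat_def hcat_mult_append_vec)
  also have "\<dots> = (?Ax + ?Apx) + (?Bu + ?Bpu)"
    using assms by (intro assoc_add_vec[symmetric, of _ nx] carrier_vecI) simp_all
  also have "\<dots> = affine_mat nx nx np As p *\<^sub>v x + affine_mat nx nu np Bs p *\<^sub>v u"
    using assms by (simp add: affine_mat_mult_vec)
  finally show ?thesis .
qed

definition closed_loop_lift_mat :: "nat \<Rightarrow> nat \<Rightarrow> nat \<Rightarrow> (nat \<Rightarrow> real mat) \<Rightarrow> real mat" where
  "closed_loop_lift_mat nx nu np Ks =
        hcat (1\<^sub>m nx) (0\<^sub>m nx (np * nx + np * np * nx))
     @\<^sub>r hcat (0\<^sub>m (np * nx) nx) (hcat (kron (1\<^sub>m np) (1\<^sub>m nx)) (0\<^sub>m (np * nx) (np * np * nx)))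
     @\<^sub>r hcat (Ks 0) (hcat (bar_mat nu nx np Ks) (0\<^sub>m nu (np * np * nx)))
     @\<^sub>r hcat (0\<^sub>m (np * nu) nx) (hcat (kron (1\<^sub>m np) (Ks 0)) (kron (1\<^sub>m np) (bar_mat nu nx np Ks)))"

lemma closed_loop_lift_mat_mult_vec:
  assumes K0: "Ks 0 \<in> carrier_mat nu nx" and x: "x \<in> carrier_vec nx" and p: "p \<in> carrier_vec np"
  defines "y \<equiv> affine_mat nu nx np Ks p *\<^sub>v x"
  shows "closed_loop_lift_mat nx nu np Ks *\<^sub>v (x @\<^sub>v kron_vec p x @\<^sub>v kron_vec p (kron_vec p x))
    = x @\<^sub>v kron_vec p x @\<^sub>v y @\<^sub>v kron_vec p y"
proof -
  define kx where "kx = kron_vec p x"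
  define kkx where "kkx = kron_vec p kx"
  have kx: "kx \<in> carrier_vec (np * nx)" and kkx: "kkx \<in> carrier_vec (np * np * nx)"
    using x p by (auto simp: kx_def kkx_def mult.assoc intro!: carrier_vecI)
  have Kkx: "bar_mat nu nx np Ks *\<^sub>v kx \<in> carrier_vec nu"
    by (intro carrier_vecI) simp
  have y_split: "y = Ks 0 *\<^sub>v x + bar_mat nu nx np Ks *\<^sub>v kx"
    unfolding y_def kx_def using K0 x p by (rule affine_mat_mult_vec)
  have "hcat (1\<^sub>m nx) (0\<^sub>m nx (np * nx + np * np * nx)) *\<^sub>v (x @\<^sub>v kx @\<^sub>v kkx) = x"
    using x kx kkx by (simp add: hcat_mult_append_vec zero_mat_mult_vec mult.assoc)
  moreover have "hcat (0\<^sub>m (np * nx) nx) (hcat (kron (1\<^sub>m np) (1\<^sub>m nx)) (0\<^sub>m (np * nx) (np * np * nx)))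
      *\<^sub>v (x @\<^sub>v kx @\<^sub>v kkx) = kx"
    using x kx kkx by (simp add: hcat_mult_append_vec zero_mat_mult_vec kron_one_one mult.assoc)
  moreover have "hcat (Ks 0) (hcat (bar_mat nu nx np Ks) (0\<^sub>m nu (np * np * nx)))
      *\<^sub>v (x @\<^sub>v kx @\<^sub>v kkx) = y"
    using x kx kkx K0 Kkx by (simp add: hcat_mult_append_vec zero_mat_mult_vec y_split mult.assoc)
  moreover have "hcat (0\<^sub>m (np * nu) nx) (hcat (kron (1\<^sub>m np) (Ks 0)) (kron (1\<^sub>m np) (bar_mat nu nx np Ks)))
      *\<^sub>v (x @\<^sub>v kx @\<^sub>v kkx) = kron_vec p y"
  proof -
    have "kron (1\<^sub>m np) (Ks 0) *\<^sub>v kx + kron (1\<^sub>m np) (bar_mat nu nx np Ks) *\<^sub>v kkx \<in> carrier_vec (np * nu)"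
      using K0 by (intro carrier_vecI) simp
    then have "hcat (0\<^sub>m (np * nu) nx) (hcat (kron (1\<^sub>m np) (Ks 0)) (kron (1\<^sub>m np) (bar_mat nu nx np Ks)))
        *\<^sub>v (x @\<^sub>v kx @\<^sub>v kkx)
      = kron (1\<^sub>m np) (Ks 0) *\<^sub>v kx + kron (1\<^sub>m np) (bar_mat nu nx np Ks) *\<^sub>v kkx"
      using x kx kkx K0 p by (simp add: hcat_mult_append_vec zero_mat_mult_vec mult.assoc)
    also have "\<dots> = kron_vec p (Ks 0 *\<^sub>v x) + kron_vec p (bar_mat nu nx np Ks *\<^sub>v kx)"
      using x K0 p by (simp add: kx_def kkx_def kron_one_mult_kron_vec)
    also have "\<dots> = kron_vec p y"
      unfolding y_split using K0 by (intro kron_vec_add_right[symmetric]) simp_all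
    finally show ?thesis .
  qed
  ultimately show ?thesis
    using x kx kkx K0 by (simp add: closed_loop_lift_mat_def append_rows_mult_vec mult.assoc flip: kx_def kkx_def)
qed

lemma shifted_state_data_mat:
  fixes nx nu np Nd :: nat and As Bs :: "nat \<Rightarrow> real mat" and ud pd xd :: "nat \<Rightarrow> real vec"
  assumes A0: "As 0 \<in> carrier_mat nx nx" and B0: "Bs 0 \<in> carrier_mat nx nu"
    and data_dim: "\<forall>k\<in>{1..<Nd}.
      ud k \<in> carrier_vec nu \<and> pd k \<in> carrier_vec np \<and> xd k \<in> carrier_vec nx"
    and data_sys: "\<forall>k\<in>{1..<Nd}. xd (Suc k) =
      affine_mat nx nx np As (pd k) *\<^sub>v xd k + affine_mat nx nu np Bs (pd k) *\<^sub>v ud k"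
  shows "data_mat nx Nd (\<lambda>k. xd (Suc k)) = system_coeff_mat nx nu np As Bs *
    (data_mat nx Nd xd @\<^sub>r data_mat (np * nx) Nd (\<lambda>k. kron_vec (pd k) (xd k))
     @\<^sub>r data_mat nu Nd ud @\<^sub>r data_mat (np * nu) Nd (\<lambda>k. kron_vec (pd k) (ud k)))"
proof -
  have dims: "dim_vec (xd k) = nx" "dim_vec (ud k) = nu" "dim_vec (pd k) = np"
    if "k \<in> {1..<Nd}" for k
    using data_dim that by auto
  define w where "w k = xd k @\<^sub>v kron_vec (pd k) (xd k) @\<^sub>v ud k @\<^sub>v kron_vec (pd k) (ud k)" for k
  have "data_mat nx Nd xd @\<^sub>r data_mat (np * nx) Nd (\<lambda>k. kron_vec (pd k) (xd k))
     @\<^sub>r data_mat nu Nd ud @\<^sub>r data_mat (np * nu) Nd (\<lambda>k. kron_vec (pd k) (ud k))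
    = data_mat (nx + (np * nx + (nu + np * nu))) Nd w"
    unfolding w_def by (simp add: append_rows_data_mat dims)
  also have "system_coeff_mat nx nu np As Bs * \<dots> = data_mat nx Nd (\<lambda>k. system_coeff_mat nx nu np As Bs *\<^sub>v w k)"
    by (intro mult_data_mat system_coeff_mat_carrier A0 B0) (simp add: w_def dims)
  also have "\<dots> = data_mat nx Nd (\<lambda>k. xd (Suc k))"
    using data_dim data_sys by (intro data_mat_cong) (simp add: w_def system_coeff_mat_mult_vec A0 B0)
  finally show ?thesis by simp
qed

lemma shifted_state_data_mat_mult:
  fixes nx nu np Nd :: nat and As Bs :: "nat \<Rightarrow> real mat" and ud pd xd :: "nat \<Rightarrow> real vec"
  assumes A0: "As 0 \<in> carrier_mat nx nx" and B0: "Bs 0 \<in> carrier_mat nx nu"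
    and data_dim: "\<forall>k\<in>{1..<Nd}.
      ud k \<in> carrier_vec nu \<and> pd k \<in> carrier_vec np \<and> xd k \<in> carrier_vec nx"
    and data_sys: "\<forall>k\<in>{1..<Nd}. xd (Suc k) =
      affine_mat nx nx np As (pd k) *\<^sub>v xd k + affine_mat nx nu np Bs (pd k) *\<^sub>v ud k"
    and V: "V \<in> carrier_mat (Nd - 1) c"
    and M_eq: "M = (data_mat nx Nd xd @\<^sub>r data_mat (np * nx) Nd (\<lambda>k. kron_vec (pd k) (xd k))
      @\<^sub>r data_mat nu Nd ud @\<^sub>r data_mat (np * nu) Nd (\<lambda>k. kron_vec (pd k) (ud k))) * V"
  shows "data_mat nx Nd (\<lambda>k. xd (Suc k)) * V = system_coeff_mat nx nu np As Bs * M"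
proof -
  let ?D = "data_mat nx Nd xd @\<^sub>r data_mat (np * nx) Nd (\<lambda>k. kron_vec (pd k) (xd k))
    @\<^sub>r data_mat nu Nd ud @\<^sub>r data_mat (np * nu) Nd (\<lambda>k. kron_vec (pd k) (ud k))"
  have D: "?D \<in> carrier_mat (nx + (np * nx + (nu + np * nu))) (Nd - 1)"
    by (intro carrier_matI) simp_all
  have "data_mat nx Nd (\<lambda>k. xd (Suc k)) * V = system_coeff_mat nx nu np As Bs * ?D * V"
    using shifted_state_data_mat[OF A0 B0 data_dim data_sys] by simp
  also have "\<dots> = system_coeff_mat nx nu np As Bs * M"
    unfolding M_eq using system_coeff_mat_carrier[where As = As and Bs = Bs, OF A0 B0] D V
    by (rule assoc_mult_mat)
  finally show ?thesis .
qed

lemma system_coeff_closed_loop_lift_mult_vec: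
  assumes "As 0 \<in> carrier_mat nx nx" "Bs 0 \<in> carrier_mat nx nu" "Ks 0 \<in> carrier_mat nu nx"
    and x: "x \<in> carrier_vec nx" and "p \<in> carrier_vec np"
  shows "(system_coeff_mat nx nu np As Bs * closed_loop_lift_mat nx nu np Ks)
      *\<^sub>v (x @\<^sub>v kron_vec p x @\<^sub>v kron_vec p (kron_vec p x))
    = (affine_mat nx nx np As p + affine_mat nx nu np Bs p * affine_mat nu nx np Ks p) *\<^sub>v x"
proof -
  let ?z = "x @\<^sub>v kron_vec p x @\<^sub>v kron_vec p (kron_vec p x)"
  let ?u = "affine_mat nu nx np Ks p *\<^sub>v x"
  have "closed_loop_lift_mat nx nu np Ks \<in> carrier_mat (nx + (np * nx + (nu + np * nu))) (dim_vec ?z)"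
    using assms by (intro carrier_matI) (simp_all add: closed_loop_lift_mat_def mult.assoc)
  then have "(system_coeff_mat nx nu np As Bs * closed_loop_lift_mat nx nu np Ks) *\<^sub>v ?z
      = system_coeff_mat nx nu np As Bs *\<^sub>v (closed_loop_lift_mat nx nu np Ks *\<^sub>v ?z)"
    using assms system_coeff_mat_carrier by (intro assoc_mult_mat_vec carrier_vecI) simp_all
  also have "\<dots> = system_coeff_mat nx nu np As Bs *\<^sub>v (x @\<^sub>v kron_vec p x @\<^sub>v ?u @\<^sub>v kron_vec p ?u)"
    using assms by (simp add: closed_loop_lift_mat_mult_vec)
  also have "\<dots> = affine_mat nx nx np As p *\<^sub>v x + affine_mat nx nu np Bs p *\<^sub>v ?u"
    using assms by (intro system_coeff_mat_mult_vec carrier_vecI) simp_all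
  also have "\<dots> = (affine_mat nx nx np As p + affine_mat nx nu np Bs p * affine_mat nu nx np Ks p) *\<^sub>v x"
    by (simp only: add_mult_distrib_mat_vec[OF affine_mat_carrier
          mult_carrier_mat[OF affine_mat_carrier affine_mat_carrier] x]
        assoc_mult_mat_vec[OF affine_mat_carrier affine_mat_carrier x])
  finally show ?thesis .
qed

theorem theorem1:
  fixes nx nu np Nd :: nat
    and As Bs Ks :: "nat \<Rightarrow> real mat"
    and P :: "real vec set"
    and ud pd xd :: "nat \<Rightarrow> real vec"
    and V :: "real mat"
  assumes As_dim: "\<forall>i\<le>np. As i \<in> carrier_mat nx nx"
    and Bs_dim: "\<forall>i\<le>np. Bs i \<in> carrier_mat nx nu"
    and Ks_dim: "\<forall>i\<le>np. Ks i \<in> carrier_mat nu nx"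
    and P_dim: "P \<subseteq> carrier_vec np"
    and data_dim: "\<forall>k\<in>{1..Nd}. ud k \<in> carrier_vec nu \<and> pd k \<in> P \<and> xd k \<in> carrier_vec nx"
    and data_sys: "\<forall>k\<in>{1..<Nd}. xd (Suc k) =
        affine_mat nx nx np As (pd k) *\<^sub>v xd k + affine_mat nx nu np Bs (pd k) *\<^sub>v ud k"
    and PE: "full_row_rank
        (data_mat nx Nd xd @\<^sub>r data_mat (np * nx) Nd (\<lambda>k. kron_vec (pd k) (xd k))
         @\<^sub>r data_mat nu Nd ud @\<^sub>r data_mat (np * nu) Nd (\<lambda>k. kron_vec (pd k) (ud k)))"
    and PE_rank: "dim_row (data_mat nx Nd xd @\<^sub>r data_mat (np * nx) Nd (\<lambda>k. kron_vec (pd k) (xd k))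
         @\<^sub>r data_mat nu Nd ud @\<^sub>r data_mat (np * nu) Nd (\<lambda>k. kron_vec (pd k) (ud k)))
        = (1 + np) * (nx + nu)"
    and V_dim: "V \<in> carrier_mat (Nd - 1) (nx * (1 + np + np ^ 2))"
    and V_eq: "hcat (1\<^sub>m nx) (0\<^sub>m nx (np * nx + np * np * nx))
        @\<^sub>r hcat (0\<^sub>m (np * nx) nx) (hcat (kron (1\<^sub>m np) (1\<^sub>m nx)) (0\<^sub>m (np * nx) (np * np * nx)))
        @\<^sub>r hcat (Ks 0) (hcat (bar_mat nu nx np Ks) (0\<^sub>m nu (np * np * nx)))
        @\<^sub>r hcat (0\<^sub>m (np * nu) nx) (hcat (kron (1\<^sub>m np) (Ks 0)) (kron (1\<^sub>m np) (bar_mat nu nx np Ks)))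
      = (data_mat nx Nd xd @\<^sub>r data_mat (np * nx) Nd (\<lambda>k. kron_vec (pd k) (xd k))
         @\<^sub>r data_mat nu Nd ud @\<^sub>r data_mat (np * nu) Nd (\<lambda>k. kron_vec (pd k) (ud k))) * V"
  shows "\<forall>p\<in>P. \<forall>x\<in>carrier_vec nx.
    (affine_mat nx nx np As p + affine_mat nx nu np Bs p * affine_mat nu nx np Ks p) *\<^sub>v x
    = (data_mat nx Nd (\<lambda>k. xd (Suc k)) * V) *\<^sub>v (x @\<^sub>v kron_vec p x @\<^sub>v kron_vec p (kron_vec p x))"
proof (intro ballI)
  fix p x :: "real vec" assume "p \<in> P" and x: "x \<in> carrier_vec nx"
  then have p: "p \<in> carrier_vec np" using P_dim by auto
  have A0: "As 0 \<in> carrier_mat nx nx" and B0: "Bs 0 \<in> carrier_mat nx nu"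
    and K0: "Ks 0 \<in> carrier_mat nu nx"
    using As_dim Bs_dim Ks_dim by auto
  have "\<forall>k\<in>{1..<Nd}. ud k \<in> carrier_vec nu \<and> pd k \<in> carrier_vec np \<and> xd k \<in> carrier_vec nx"
    using data_dim P_dim by auto
  from shifted_state_data_mat_mult[where As = As and Bs = Bs, OF A0 B0 this data_sys V_dim
      V_eq[folded closed_loop_lift_mat_def]]
  have "data_mat nx Nd (\<lambda>k. xd (Suc k)) * V = system_coeff_mat nx nu np As Bs * closed_loop_lift_mat nx nu np Ks" .
  with system_coeff_closed_loop_lift_mult_vec[where As = As and Bs = Bs and Ks = Ks, OF A0 B0 K0 x p]
  show "(affine_mat nx nx np As p + affine_mat nx nu np Bs p * affine_mat nu nx np Ks p) *\<^sub>v x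
    = (data_mat nx Nd (\<lambda>k. xd (Suc k)) * V) *\<^sub>v (x @\<^sub>v kron_vec p x @\<^sub>v kron_vec p (kron_vec p x))"
    by simp
qed

end
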